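(* Let $N\ge 1$ be an integer, let $R=N/2$, and let $$q(z)=\frac2N\sum_{j=1}^N\Big(1-\frac{j}{N+1}\Big)z^j .$$ Then the set $$M_R=\{z\in\mathbb C:|z+R|<R\}\cup\{z\in\mathbb C:|z|<1\}$$ satisfies $M_R\subset\big(\overline{\mathbb C}\setminus q(\overline{\mathbb D})\big)^*$; that is, with $\alpha_j=\frac2N\big(1-\frac{j}{N+1}\big)$, the polynomial $\lambda^N-\mu\sum_{j=1}^N\alpha_j\lambda^{N-j}$ is Schur stable for every $\mu\in M_R$.
   Context: $\overline{\mathbb C}$ is the extended complex plane and $\overline{\mathbb D}=\{z\in\mathbb C:|z|\le 1\}$. For $E\subset\overline{\mathbb C}$, $E^*=\{1/\bar z: z\in E\}$ denotes the inversion of $E$ with respect to the unit circle (with $1/0=\infty$ and $1/\infty=0$). A polynomial is Schur stable if all its zeros lie in the open unit disc. Background: for the system $x_{n+1}=F_h(x_n)$, $x_n\in\mathbb R^m$, with the nonlinear control $u=-\sum_{j=1}^{N-1}\varepsilon_j\big(F_h(x_{n-j+1})-F_h(x_{n-j})\big)$, the linearization of the closed-loop system around an equilibrium has characteristic equation $\prod_{k=1}^m\big(\lambda^N-\mu_kP(\lambda)\big)=0$, where $\mu_k$ are the eigenvalues of the Jacobi matrix of $F_h$, $P(\lambda)=\sum_{j=1}^N\alpha_j\lambda^{N-j}$ and $\sum_{j=1}^N\alpha_j=1$; with $q(z)=\sum_{j=1}^N\alpha_jz^j$, the family $\{\lambda^N-\mu P(\lambda):\mu\in M\}$ is Schur stable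 exactly when $M\subset(\overline{\mathbb C}\setminus q(\overline{\mathbb D}))^*$. *)

theory Defs
  imports Complex_Main "HOL-Computational_Algebra.Polynomial"
begin

text \<open>The extended complex plane, with \<open>None\<close> as the point at infinity and \<open>Some\<close> as the
  embedding of the complex numbers (the carrier of the library's one-point compactification
  \<open>Alexandroff_compactification\<close>).\<close>

type_synonym ecomplex = "complex option"

fun circle_inversion :: "ecomplex \<Rightarrow> ecomplex" where
  "circle_inversion None = Some 0"
| "circle_inversion (Some z) = (if z = 0 then None else Some (1 / cnj z))"

definition inversion_set :: "ecomplex set \<Rightarrow> ecomplex set" where
  "inversion_set E = circle_inversion ` E"

definition schur_stable :: "complex poly \<Rightarrow> bool" where
  "schur_stable p \<longleftrightarrow> (\<forall>z. poly p z = 0 \<longrightarrow> cmod z < 1)"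

definition \<alpha> :: "nat \<Rightarrow> nat \<Rightarrow> real" where
  "\<alpha> N j = 2 / real N * (1 - real j / (real N + 1))"

definition q :: "nat \<Rightarrow> complex \<Rightarrow> complex" where
  "q N z = 2 / of_nat N * (\<Sum>j=1..N. (1 - of_nat j / (of_nat N + 1)) * z ^ j)"

definition M :: "real \<Rightarrow> complex set" where
  "M R = {z. cmod (z + of_real R) < R} \<union> {z. cmod z < 1}"

text \<open>The polynomial \<open>\<lambda>\<^sup>N - \<mu> P(\<lambda>)\<close> with \<open>P(\<lambda>) = \<Sum>\<^sub>j \<alpha>\<^sub>j \<lambda>\<^bsup>N-j\<^esup>\<close>.\<close>

definition char_poly :: "nat \<Rightarrow> complex \<Rightarrow> complex poly" where
  "char_poly N \<mu> = monom 1 N - smult \<mu> (\<Sum>j=1..N. monom (of_real (\<alpha> N j)) (N - j))"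

end

theory Submission
  imports Defs
begin

text \<open>
  Since \<open>\<lambda>\<^sup>N - \<mu> P(\<lambda>) = \<lambda>\<^sup>N (1 - \<mu> q(1/\<lambda>))\<close>, both claims say that \<open>\<mu> q(z) \<noteq> 1\<close> for \<open>\<bar>z\<bar> \<le> 1\<close>
  and \<open>\<mu>\<close> in \<open>M R\<close>; the conjugation in the inversion is harmless because \<open>q\<close> has real coefficients.
  The two pieces of \<open>M R\<close> are handled by two bounds for \<open>q\<close> on the closed disc.

  For \<open>\<bar>\<mu>\<bar> < 1\<close>, the coefficients of \<open>q\<close> are nonnegative with sum \<open>1\<close>, so \<open>\<bar>q(z)\<bar> \<le> 1\<close>.

  For \<open>\<bar>\<mu> + R\<bar> < R\<close>, inversion turns the disc into the half-plane \<open>Re (1/\<mu>) < -1/N\<close>, so it suffices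
  that \<open>1 + N Re q(z) \<ge> 0\<close> (lemma \<open>Re_q_ge\<close>). On the unit circle the left-hand side is the Fejer
  kernel. The square formula for that kernel has an analogue valid in the whole
  disc, so that no maximum principle is involved: with \<open>u\<^sub>k = 1 + z + \<dots> + z\<^sup>k\<close> one has
  \<open>(N + 1) (1 + N q(z)) = \<Sum>\<^sub>k\<^sub>\<le>\<^sub>N (2 u\<^sub>k - 1)\<close>, and the recurrence \<open>u\<^sub>k - 1 = z u\<^sub>k\<^sub>-\<^sub>1\<close> gives
  \<open>Re (2 u\<^sub>k - 1) = \<bar>u\<^sub>k\<bar>\<^sup>2 - \<bar>z\<bar>\<^sup>2 \<bar>u\<^sub>k\<^sub>-\<^sub>1\<bar>\<^sup>2 \<ge> \<bar>u\<^sub>k\<bar>\<^sup>2 - \<bar>u\<^sub>k\<^sub>-\<^sub>1\<bar>\<^sup>2\<close>, which telescopes.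
\<close>

lemma q_eq_sum_\<alpha>: "q N z = (\<Sum>j=1..N. of_real (\<alpha> N j) * z ^ j)"
  unfolding q_def \<alpha>_def sum_distrib_left by (intro sum.cong) (simp_all add: mult.assoc)

lemma \<alpha>_nonneg: "j \<le> N \<Longrightarrow> 0 \<le> \<alpha> N j"
  unfolding \<alpha>_def by (intro mult_nonneg_nonneg) (auto simp: divide_simps)

lemma sum_\<alpha>:
  assumes "N \<ge> 1"
  shows "(\<Sum>j=1..N. \<alpha> N j) = 1"
proof -
  have gauss: "(\<Sum>j=1..N. real j) = real N * (real N + 1) / 2" for N
    by (induction N) (auto simp: field_simps)
  have "(\<Sum>j=1..N. \<alpha> N j) = 2 / real N * (real N - (\<Sum>j=1..N. real j) / (real N + 1))"
    by (simp add: \<alpha>_def sum_distrib_left[symmetric] sum_subtractf sum_divide_distrib[symmetric])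
  also have "(\<Sum>j=1..N. real j) / (real N + 1) = real N / 2"
    unfolding gauss by (simp add: divide_simps)
  also have "2 / real N * (real N - real N / 2) = 1"
    using assms by simp
  finally show ?thesis .
qed

lemma norm_q_le_1:
  assumes "N \<ge> 1" "cmod z \<le> 1"
  shows "cmod (q N z) \<le> 1"
proof -
  have "cmod (q N z) \<le> (\<Sum>j=1..N. \<alpha> N j)"
    unfolding q_eq_sum_\<alpha>
  proof (rule sum_norm_le)
    fix j assume j: "j \<in> {1..N}"
    have "\<alpha> N j * cmod z ^ j \<le> \<alpha> N j * 1"
      using j assms by (intro mult_left_mono power_le_one) (auto simp: \<alpha>_nonneg)
    then show "cmod (of_real (\<alpha> N j) * z ^ j) \<le> \<alpha> N j"
      using j by (simp add: norm_mult norm_power \<alpha>_nonneg)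
  qed
  then show ?thesis
    using sum_\<alpha>[OF assms(1)] by simp
qed

lemma cnj_q: "cnj (q N z) = q N (cnj z)"
  by (simp add: q_eq_sum_\<alpha>)

text \<open>The Cesaro form of \<open>q\<close>: the power \<open>z\<^sup>j\<close> occurs in exactly the \<open>n + 1 - j\<close> partial sums
  with \<open>j \<le> k \<le> n\<close>.\<close>

lemma sum_geometric_partial_sums:
  fixes z :: "'a :: comm_ring_1"
  shows "(\<Sum>k\<le>n. \<Sum>i\<le>k. z ^ i) = (\<Sum>j\<le>n. (of_nat n + 1 - of_nat j) * z ^ j)"
proof (induction n)
  case (Suc n)
  have "(\<Sum>j\<le>n. (of_nat (Suc n) + 1 - of_nat j) * z ^ j)
      = (\<Sum>j\<le>n. (of_nat n + 1 - of_nat j) * z ^ j) + (\<Sum>j\<le>n. z ^ j)"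
    unfolding sum.distrib[symmetric] by (intro sum.cong) (auto simp: algebra_simps)
  then show ?case
    using Suc by (simp add: algebra_simps)
qed simp

lemma q_as_cesaro_sum:
  assumes "N \<ge> 1"
  shows "(of_nat N + 1) * (1 + of_nat N * q N z) = (\<Sum>k\<le>N. 2 * (\<Sum>i\<le>k. z ^ i) - 1)"
proof -
  have N1: "(of_nat N + 1 :: complex) \<noteq> 0"
    using of_nat_neq_0[of N, where 'a = complex] by (simp add: add.commute)
  have coeff: "(of_nat N + 1) * (1 - of_nat j / (of_nat N + 1)) = (of_nat N + 1 - of_nat j :: complex)"
    for j
    using N1 by (simp add: right_diff_distrib)
  have "(of_nat N + 1) * (of_nat N * q N z)
      = 2 * ((of_nat N + 1) * (\<Sum>j=1..N. (1 - of_nat j / (of_nat N + 1)) * z ^ j))"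
    using assms by (simp add: q_def)
  also have "\<dots> = 2 * (\<Sum>j=1..N. (of_nat N + 1 - of_nat j) * z ^ j)"
    unfolding sum_distrib_left[of "of_nat N + 1"] mult.assoc[symmetric] coeff ..
  also have "(\<Sum>j=1..N. (of_nat N + 1 - of_nat j) * z ^ j)
      = (\<Sum>j\<le>N. (of_nat N + 1 - of_nat j) * z ^ j) - (of_nat N + 1)"
    by (simp add: atMost_atLeast0 sum.atLeast_Suc_atMost)
  finally have "(of_nat N + 1) * (of_nat N * q N z)
      = 2 * (\<Sum>k\<le>N. \<Sum>i\<le>k. z ^ i) - 2 * (of_nat N + 1)"
    by (simp add: sum_geometric_partial_sums algebra_simps)
  then show ?thesis
    by (simp add: sum_subtractf sum_distrib_left[symmetric] algebra_simps)
qed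

text \<open>The bound by a square, and not just by \<open>0\<close>, is what the telescoping argument proves.\<close>

lemma Re_cesaro_sum_ge:
  assumes "cmod z \<le> 1"
  shows "(cmod (\<Sum>i\<le>n. z ^ i))\<^sup>2 \<le> Re (\<Sum>k\<le>n. 2 * (\<Sum>i\<le>k. z ^ i) - 1)"
proof (induction n)
  case (Suc n)
  define u where "u k = (\<Sum>i\<le>k. z ^ i)" for k
  have rec: "u (Suc n) - 1 = z * u n"
    unfolding u_def sum.atMost_Suc_shift by (simp add: sum_distrib_left)
  have "(cmod (u (Suc n)))\<^sup>2 - (2 * Re (u (Suc n)) - 1) = (cmod (u (Suc n) - 1))\<^sup>2"
    by (simp add: cmod_power2) (simp add: power2_eq_square algebra_simps)
  also have "\<dots> = (cmod z)\<^sup>2 * (cmod (u n))\<^sup>2"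
    by (simp add: rec norm_mult power_mult_distrib)
  also have "\<dots> \<le> (cmod (u n))\<^sup>2"
    using assms by (intro mult_left_le_one_le) (auto simp: power_le_one)
  finally show ?case
    using Suc by (simp flip: u_def del: sum.atMost_Suc add: sum.atMost_Suc[of "\<lambda>k. 2 * u k - 1"])
qed simp

lemma Re_q_ge:
  assumes "N \<ge> 1" "cmod z \<le> 1"
  shows "0 \<le> 1 + real N * Re (q N z)"
proof -
  have "0 \<le> Re ((of_nat N + 1) * (1 + of_nat N * q N z))"
    unfolding q_as_cesaro_sum[OF assms(1)]
    by (rule order_trans[OF zero_le_power2 Re_cesaro_sum_ge[OF assms(2)]])
  also have "\<dots> = (real N + 1) * (1 + real N * Re (q N z))"
    by (simp add: algebra_simps)
  finally show ?thesis
    by (simp add: zero_le_mult_iff)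
qed

lemma mult_q_neq_1:
  assumes N: "N \<ge> 1" and z: "cmod z \<le> 1" and \<mu>: "\<mu> \<in> M (real N / 2)"
  shows "\<mu> * q N z \<noteq> 1"
proof
  assume eq: "\<mu> * q N z = 1"
  define w where "w = q N z"
  have w0: "w \<noteq> 0"
    using eq by (auto simp: w_def)
  have \<mu>w: "\<mu> * w = 1"
    using eq by (simp add: w_def)
  from \<mu> consider "cmod \<mu> < 1" | "cmod (\<mu> + of_real (real N / 2)) < real N / 2"
    by (auto simp: M_def)
  then show False
  proof cases
    case 1
    have "cmod \<mu> * cmod w = 1"
      using \<mu>w by (metis norm_mult norm_one)
    moreover have "cmod \<mu> * cmod w \<le> cmod \<mu> * 1"
      using norm_q_le_1[OF N z] by (intro mult_left_mono) (auto simp: w_def)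
    ultimately show False
      using 1 by simp
  next
    case 2
    define r where "r = real N / 2"
    have "cmod (1 + of_real r * w) = cmod (\<mu> + of_real r) * cmod w"
      by (simp add: norm_mult[symmetric] distrib_right \<mu>w)
    also have "\<dots> < r * cmod w"
      using 2 w0 by (intro mult_strict_right_mono) (auto simp: r_def)
    finally have "(cmod (1 + of_real r * w))\<^sup>2 < (r * cmod w)\<^sup>2"
      by (intro power_strict_mono) auto
    then have "1 + 2 * r * Re w < 0"
      by (simp add: cmod_power2 power_mult_distrib) (simp add: power2_eq_square algebra_simps)
    then show False
      using Re_q_ge[OF N z] by (simp add: r_def w_def)
  qed
qed

lemma poly_char_poly:
  assumes "x \<noteq> 0"
  shows "poly (char_poly N \<mu>) x = x ^ N * (1 - \<mu> * q N (1 / x))"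
proof -
  have "(\<Sum>j=1..N. of_real (\<alpha> N j) * x ^ (N - j)) = x ^ N * q N (1 / x)"
    unfolding q_eq_sum_\<alpha> sum_distrib_left
    using assms by (intro sum.cong) (auto simp: power_diff power_one_over field_simps)
  then show ?thesis
    by (simp add: char_poly_def poly_monom poly_sum algebra_simps)
qed

theorem mainTheorem7:
  fixes N :: nat and R :: real
  assumes "N \<ge> 1" and "R = real N / 2"
  shows "Some ` M R \<subseteq> inversion_set (UNIV - Some ` (q N ` {z. cmod z \<le> 1}))
    \<and> (\<forall>\<mu>\<in>M R. schur_stable (char_poly N \<mu>))"
proof (intro conjI ballI)
  show "Some ` M R \<subseteq> inversion_set (UNIV - Some ` (q N ` {z. cmod z \<le> 1}))"
  proof clarify
    fix \<mu> assume \<mu>: "\<mu> \<in> M R"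
    \<comment> \<open>The inversion is an involution, so the preimage of \<open>\<mu>\<close> is its own inversion.\<close>
    have "circle_inversion (Some \<mu>) \<notin> Some ` (q N ` {z. cmod z \<le> 1})"
    proof
      assume "circle_inversion (Some \<mu>) \<in> Some ` (q N ` {z. cmod z \<le> 1})"
      then obtain z where z: "\<mu> \<noteq> 0" "cmod z \<le> 1" "1 / cnj \<mu> = q N z"
        by (auto split: if_splits)
      then have "\<mu> * q N (cnj z) = 1"
        by (simp flip: cnj_q z(3))
      with mult_q_neq_1[OF assms(1), of "cnj z" \<mu>] z \<mu> assms(2) show False
        by simp
    qed
    moreover have "circle_inversion (circle_inversion (Some \<mu>)) = Some \<mu>"
      by simp
    ultimately show "Some \<mu> \<in> inversion_set (UNIV - Some ` (q N ` {z. cmod z \<le> 1}))"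
      unfolding inversion_set_def by (metis Diff_iff UNIV_I image_eqI)
  qed
next
  fix \<mu> assume \<mu>: "\<mu> \<in> M R"
  show "schur_stable (char_poly N \<mu>)"
    unfolding schur_stable_def
  proof (intro allI impI, rule ccontr)
    fix x assume root: "poly (char_poly N \<mu>) x = 0" and "\<not> cmod x < 1"
    then have ge: "cmod x \<ge> 1" and nz: "x \<noteq> 0"
      by auto
    then have "cmod (1 / x) \<le> 1"
      by (simp add: norm_divide)
    with mult_q_neq_1[OF assms(1), of "1 / x" \<mu>] root \<mu> assms(2) nz show False
      by (simp add: poly_char_poly)
  qed
qed

end
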